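(* Let $\varrho$ be a primitive inflation rule in one dimension, with inflation multiplier $\lambda$ and Fourier matrix $B(k)$. Then, for Lebesgue-a.e. $k\in\mathbb R$, one has $\chi_{\min}(k)\geqslant0$ or, equivalently, $\chi^B(k)\leqslant\log\sqrt\lambda$.
   Context: Let $\mathcal A=\{a_1,\dots,a_{n_a}\}$ be a finite alphabet and $\varrho$ a primitive substitution on $\mathcal A$: each letter is mapped to a non-empty finite word, and the substitution matrix $M_\varrho=(M_{ij})$, with $M_{ij}$ the number of letters $a_i$ in $\varrho(a_j)$, is primitive. Let $\lambda>1$ be its Perron–Frobenius (PF) eigenvalue, called the inflation multiplier. The associated (geometric) inflation rule, also denoted $\varrho$, uses intervals (prototiles) of natural lengths $\ell_1,\dots,\ell_{n_a}>0$, where $(\ell_1,\dots,\ell_{n_a})$ is a fixed left PF eigenvector of $M_\varrho$; a tile of type $a_i$ is expanded by $\lambda$ and then dissected into tiles of the original sizes in the order specified by $\varrho(a_i)$. Displacement sets and Fourier matrix: $T_{ij}$ is the set of all relative positions (left endpoints, relative to the left endpoint of the patch) of tiles of type $a_i$ in the patch $\varrho(a_j)$ (an interval of length $\lambda\ell_j$ dissected into tiles). $B(k)=(B_{ij}(k))_{1\leqslant i,j\leqslant n_a}$ with $B_{ij}(k)=\sum_{t\in T_{ij}}\mathrm e^{2\pi\mathrm i tk}$. The Fourier matrix cocycle is $B^{(n)}(k)=B(k)B(\lambda k)\cdots B(\lambda^{n-1}k)$. With any matrix norm, $$\chi^B(k)=\limsup_{n\to\infty}\frac1n\log\|B^{(n)}(k)\|,\qquad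 \chi_{\min}(k)=\log\sqrt\lambda-\chi^B(k).$$ *)

theory Defs
  imports "HOL-Analysis.Analysis"
begin

text \<open>
  The alphabet is a finite type \<open>'a\<close>, and a substitution is given by the images of the letters.
\<close>

definition substitution :: "('a::finite \<Rightarrow> 'a list) \<Rightarrow> bool" where
  "substitution \<rho> \<longleftrightarrow> (\<forall>a. \<rho> a \<noteq> [])"

definition substitution_matrix :: "('a::finite \<Rightarrow> 'a list) \<Rightarrow> real^'a^'a" where
  "substitution_matrix \<rho> = (\<chi> i j. real (count_list (\<rho> j) i))"

definition primitive_matrix :: "real^'a::finite^'a \<Rightarrow> bool" where
  "primitive_matrix M \<longleftrightarrow>
     (\<forall>i j. 0 \<le> M $ i $ j) \<and> (\<exists>p>0. \<forall>i j. 0 < (((**) M ^^ p) (mat 1)) $ i $ j)"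

definition primitive_substitution :: "('a::finite \<Rightarrow> 'a list) \<Rightarrow> bool" where
  "primitive_substitution \<rho> \<longleftrightarrow> substitution \<rho> \<and> primitive_matrix (substitution_matrix \<rho>)"

definition complex_eigenvalues :: "real^'a::finite^'a \<Rightarrow> complex set" where
  "complex_eigenvalues M =
     {\<mu>. \<exists>v::complex^'a. v \<noteq> 0 \<and> (\<chi> i j. complex_of_real (M $ i $ j)) *v v = \<mu> *s v}"

text \<open>
  The Perron--Frobenius eigenvalue of a primitive matrix is its eigenvalue of largest modulus,
  that is, its spectral radius.
\<close>

definition pf_eigenvalue :: "real^'a::finite^'a \<Rightarrow> real" where
  "pf_eigenvalue M = Max (cmod ` complex_eigenvalues M)"

definition left_pf_eigenvector :: "real^'a::finite^'a \<Rightarrow> real^'a \<Rightarrow> bool" where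
  "left_pf_eigenvector M l \<longleftrightarrow> (\<forall>i. 0 < l $ i) \<and> l v* M = pf_eigenvalue M *s l"

definition inflation_multiplier :: "('a::finite \<Rightarrow> 'a list) \<Rightarrow> real" where
  "inflation_multiplier \<rho> = pf_eigenvalue (substitution_matrix \<rho>)"

text \<open>
  In the patch of tiles spelled by the word \<open>w\<close>, started at the origin, the tile with index \<open>p\<close>
  has its left endpoint at the sum of the lengths of the tiles before it; \<open>l\<close> is the vector of
  prototile lengths.
\<close>

definition tile_position :: "real^'a::finite \<Rightarrow> 'a list \<Rightarrow> nat \<Rightarrow> real" where
  "tile_position l w p = (\<Sum>q<p. l $ (w ! q))"

definition displacement_set ::
    "('a::finite \<Rightarrow> 'a list) \<Rightarrow> real^'a \<Rightarrow> 'a \<Rightarrow> 'a \<Rightarrow> real set" where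
  "displacement_set \<rho> l i j =
     {tile_position l (\<rho> j) p | p. p < length (\<rho> j) \<and> \<rho> j ! p = i}"

definition fourier_matrix ::
    "('a::finite \<Rightarrow> 'a list) \<Rightarrow> real^'a \<Rightarrow> real \<Rightarrow> complex^'a^'a" where
  "fourier_matrix \<rho> l k =
     (\<chi> i j. \<Sum>t\<in>displacement_set \<rho> l i j. exp (2 * of_real pi * \<i> * of_real t * of_real k))"

fun fourier_cocycle ::
    "('a::finite \<Rightarrow> 'a list) \<Rightarrow> real^'a \<Rightarrow> nat \<Rightarrow> real \<Rightarrow> complex^'a^'a" where
  "fourier_cocycle \<rho> l 0 k = mat 1"
| "fourier_cocycle \<rho> l (Suc n) k =
     fourier_cocycle \<rho> l n k ** fourier_matrix \<rho> l (inflation_multiplier \<rho> ^ n * k)"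

text \<open>
  An arbitrary norm on the complex vector space of square matrices; it need not be
  submultiplicative.
\<close>

definition matrix_norm :: "(complex^'a::finite^'a \<Rightarrow> real) \<Rightarrow> bool" where
  "matrix_norm N \<longleftrightarrow>
     (\<forall>A. 0 \<le> N A) \<and> (\<forall>A. N A = 0 \<longleftrightarrow> A = 0) \<and>
     (\<forall>c A. N (\<chi> i j. c * A $ i $ j) = cmod c * N A) \<and>
     (\<forall>A B. N (A + B) \<le> N A + N B)"

text \<open>
  The cocycle may vanish at some \<open>k\<close>, and \<open>ln 0 = 0\<close> would give the wrong exponent there. The
  logarithm and the exponents therefore take values in the extended reals, with
  \<open>log 0 = -\<infinity>\<close>.
\<close>

definition log_ereal :: "real \<Rightarrow> ereal" where
  "log_ereal x = (if x = 0 then -\<infinity> else ereal (ln x))"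

definition lyapunov_exponent ::
    "(complex^'a^'a \<Rightarrow> real) \<Rightarrow> ('a::finite \<Rightarrow> 'a list) \<Rightarrow> real^'a \<Rightarrow> real \<Rightarrow> ereal" where
  "lyapunov_exponent N \<rho> l k =
     limsup (\<lambda>n. ereal (1 / real n) * log_ereal (N (fourier_cocycle \<rho> l n k)))"

definition min_exponent ::
    "(complex^'a^'a \<Rightarrow> real) \<Rightarrow> ('a::finite \<Rightarrow> 'a list) \<Rightarrow> real^'a \<Rightarrow> real \<Rightarrow> ereal" where
  "min_exponent N \<rho> l k =
     ereal (ln (sqrt (inflation_multiplier \<rho>))) - lyapunov_exponent N \<rho> l k"

end

theory Submission
  imports Defs "HOL-Real_Asymp.Real_Asymp"
begin

text \<open>
  The entry \<open>(i, j)\<close> of the cocycle is the exponential sum over the positions of the tiles of type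
  \<open>i\<close> in the \<open>n\<close>-th inflation of the tile \<open>j\<close>. These are \<open>O(\<lambda>\<^sup>n)\<close> frequencies, uniformly
  separated by the shortest tile length. Hence the mean square of the entry over any bounded interval
  is \<open>O(\<lambda>\<^sup>n)\<close>: against the weight \<open>R\<^sup>2 - k\<^sup>2\<close> on \<open>[-R, R]\<close>, the cross term of two frequencies decays
  like the inverse square of their distance. Dividing by \<open>n\<^sup>2 \<lambda>\<^sup>n\<close> and summing over \<open>n\<close> gives an integrable
  function, so for almost every \<open>k\<close> the entries are eventually at most \<open>n \<lambda>\<^bsup>n/2\<^esup>\<close>.
\<close>

section \<open>Mean squares of exponential sums with separated frequencies\<close>

lemma has_integral_parabola_cos:
  fixes x R :: real
  assumes "x \<noteq> 0" "0 \<le> R"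
  shows "((\<lambda>k. (R\<^sup>2 - k\<^sup>2) * cos (x * k)) has_integral
           (4 * sin (x * R) / x ^ 3 - 4 * R * cos (x * R) / x\<^sup>2)) {-R..R}"
proof -
  \<comment> \<open>Integration by parts twice. The weight kills the \<open>1 / x\<close> term at
    both endpoints, which is what improves the decay to \<open>1 / x\<^sup>2\<close>.\<close>
  define F where "F = (\<lambda>k. (R\<^sup>2 - k\<^sup>2) * sin (x * k) / x - 2 * k * cos (x * k) / x\<^sup>2
    + 2 * sin (x * k) / x ^ 3)"
  have "((\<lambda>k. (R\<^sup>2 - k\<^sup>2) * cos (x * k)) has_integral (F R - F (-R))) {-R..R}"
  proof (rule fundamental_theorem_of_calculus)
    fix k assume "k \<in> {-R..R}"
    have "(F has_real_derivative (R\<^sup>2 - k\<^sup>2) * cos (x * k)) (at k within {-R..R})"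
      unfolding F_def using assms
      by (auto intro!: derivative_eq_intros simp: field_simps power2_eq_square power3_eq_cube)
    then show "(F has_vector_derivative (R\<^sup>2 - k\<^sup>2) * cos (x * k)) (at k within {-R..R})"
      by (simp add: has_real_derivative_iff_has_vector_derivative)
  qed (use assms in auto)
  moreover have "F R - F (-R) = 4 * sin (x * R) / x ^ 3 - 4 * R * cos (x * R) / x\<^sup>2"
    by (simp add: F_def)
  ultimately show ?thesis by simp
qed

text \<open>The first bound serves the diagonal of a double sum over frequencies, the second the
  off-diagonal terms, where the decay must be summable.\<close>

lemma has_integral_parabola_cos_le:
  fixes x R :: real
  assumes "0 \<le> R" and J: "((\<lambda>k. (R\<^sup>2 - k\<^sup>2) * cos (x * k)) has_integral J) {-R..R}"
  shows "J \<le> 2 * R ^ 3" and "x \<noteq> 0 \<Longrightarrow> J \<le> 8 * R / x\<^sup>2"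
proof -
  show "J \<le> 2 * R ^ 3"
  proof -
    have "((\<lambda>k. R\<^sup>2) has_integral (2 * R ^ 3)) {-R..R}"
      using has_integral_const_real[of "R\<^sup>2" "-R" R] assms(1)
      by (simp add: power2_eq_square power3_eq_cube algebra_simps)
    with J show ?thesis
    proof (rule has_integral_le)
      fix k assume k: "k \<in> {-R..R}"
      then have "k\<^sup>2 \<le> R\<^sup>2"
        using assms(1) by (intro abs_le_square_iff[THEN iffD1]) auto
      then have "(R\<^sup>2 - k\<^sup>2) * cos (x * k) \<le> (R\<^sup>2 - k\<^sup>2) * 1"
        by (intro mult_left_mono) auto
      then show "(R\<^sup>2 - k\<^sup>2) * cos (x * k) \<le> R\<^sup>2"
        by (smt (verit) zero_le_power2)
    qed
  qed
  show "J \<le> 8 * R / x\<^sup>2" if x: "x \<noteq> 0"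
  proof -
    have "J = 4 * sin (x * R) / x ^ 3 - 4 * R * cos (x * R) / x\<^sup>2"
      by (rule has_integral_unique[OF J has_integral_parabola_cos[OF x assms(1)]])
    also have "\<dots> \<le> 4 * R / x\<^sup>2 + 4 * R / x\<^sup>2"
    proof -
      have "4 * sin (x * R) / x ^ 3 \<le> \<bar>4 * sin (x * R) / x ^ 3\<bar>"
        by (rule abs_ge_self)
      also have "\<dots> = 4 * \<bar>sin (x * R)\<bar> / \<bar>x\<bar> ^ 3"
        by (simp add: abs_mult power_abs)
      \<comment> \<open>The bound on the sine trades one power of \<open>x\<close>, so the estimate
        stays quadratic for small \<open>x\<close> too.\<close>
      also have "\<dots> \<le> 4 * (\<bar>x\<bar> * R) / \<bar>x\<bar> ^ 3"
        using abs_sin_x_le_abs_x[of "x * R"] assms(1)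
        by (intro divide_right_mono mult_left_mono) (auto simp: abs_mult)
      also have "\<dots> = 4 * R / x\<^sup>2"
        using x by (simp add: power2_eq_square power3_eq_cube field_simps)
      finally have "4 * sin (x * R) / x ^ 3 \<le> 4 * R / x\<^sup>2" .
      moreover have "- (4 * R * cos (x * R)) \<le> 4 * R"
      proof -
        have "4 * R * (- cos (x * R)) \<le> 4 * R * 1"
          using assms(1) by (intro mult_left_mono) (auto simp: minus_le_iff)
        then show ?thesis by simp
      qed
      then have "- (4 * R * cos (x * R)) / x\<^sup>2 \<le> 4 * R / x\<^sup>2"
        by (intro divide_right_mono) auto
      ultimately show ?thesis
        unfolding diff_conv_add_uminus minus_divide_left by (rule add_mono)
    qed
    finally show ?thesis by simp
  qed
qed

text \<open>Each side of \<open>p\<close> contributes at most the full sum of inverse squares,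
  \<open>pi\<^sup>2 / 6\<close>, wherever \<open>p\<close> lies.\<close>

lemma sum_inverse_square_dist_le:
  fixes p M :: nat
  shows "(\<Sum>q\<in>{..<M} - {p}. 1 / (real p - real q)\<^sup>2) \<le> pi\<^sup>2 / 3"
proof -
  have le: "(\<Sum>m<n. 1 / (real (Suc m))\<^sup>2) \<le> pi\<^sup>2 / 6" for n
    using sum_le_suminf[OF sums_summable[OF inverse_squares_sums], of "{..<n}"]
      sums_unique[OF inverse_squares_sums]
    by (simp add: add.commute)
  have "(\<Sum>q\<in>{..<M} - {p}. 1 / (real p - real q)\<^sup>2) \<le>
      (\<Sum>q\<in>{..<p} \<union> {Suc p..<Suc p + M}. 1 / (real p - real q)\<^sup>2)"
    by (intro sum_mono2) auto
  also have "\<dots> = (\<Sum>q<p. 1 / (real p - real q)\<^sup>2) + (\<Sum>q\<in>{Suc p..<Suc p + M}. 1 / (real p - real q)\<^sup>2)"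
    by (intro sum.union_disjoint) auto
  also have "(\<Sum>q<p. 1 / (real p - real q)\<^sup>2) = (\<Sum>m<p. 1 / (real (Suc m))\<^sup>2)"
    by (rule sum.reindex_bij_witness[of _ "\<lambda>m. p - Suc m" "\<lambda>q. p - Suc q"])
       (auto simp: of_nat_diff Suc_diff_Suc)
  also have "(\<Sum>q\<in>{Suc p..<Suc p + M}. 1 / (real p - real q)\<^sup>2) = (\<Sum>m<M. 1 / (real (Suc m))\<^sup>2)"
    by (rule sum.reindex_bij_witness[of _ "\<lambda>m. Suc p + m" "\<lambda>q. q - Suc p"])
       (auto simp: of_nat_diff power2_commute)
  finally show ?thesis
    using le[of p] le[of M] by simp
qed

lemma norm_sum_cis_square:
  "(cmod (\<Sum>p\<in>P. cis (a p)))\<^sup>2 = (\<Sum>p\<in>P. \<Sum>q\<in>P. cos (a p - a q))"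
proof -
  have "(cmod (\<Sum>p\<in>P. cis (a p)))\<^sup>2 = (\<Sum>p\<in>P. cos (a p))\<^sup>2 + (\<Sum>p\<in>P. sin (a p))\<^sup>2"
    by (simp add: cmod_power2)
  also have "\<dots> = (\<Sum>p\<in>P. \<Sum>q\<in>P. cos (a p - a q))"
    by (simp add: power2_eq_square sum_product cos_diff sum.distrib)
  finally show ?thesis .
qed

text \<open>The square expands into cosines of frequency differences. Every row of this double sum
  is bounded by the same constant, and there are at most \<open>M\<close> rows. Taking a subset
  \<open>P\<close> of the indices allows for the positions of a single tile type in a word.\<close>

lemma separated_exponential_sum_mean_square:
  fixes R \<delta> :: real and x :: "nat \<Rightarrow> real"
  assumes "0 \<le> R" "0 < \<delta>"
    and P: "P \<subseteq> {..<M}"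
    and sep: "\<And>p q. p \<in> P \<Longrightarrow> q \<in> P \<Longrightarrow> \<delta> * \<bar>real p - real q\<bar> \<le> \<bar>x p - x q\<bar>"
  shows "\<exists>I \<le> (2 * R ^ 3 + 8 * R / \<delta>\<^sup>2 * (pi\<^sup>2 / 3)) * real M.
    ((\<lambda>k. (R\<^sup>2 - k\<^sup>2) * (cmod (\<Sum>p\<in>P. cis (x p * k)))\<^sup>2) has_integral I) {-R..R}"
proof -
  define C where "C = 2 * R ^ 3 + 8 * R / \<delta>\<^sup>2 * (pi\<^sup>2 / 3)"
  have "0 \<le> C"
    using assms(1,2) by (simp add: C_def)
  have "finite P"
    using P finite_subset by blast
  \<comment> \<open>Defined as an integral, not by the closed form, so that the diagonal case
    \<open>y = 0\<close> is included.\<close>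
  define J where "J y = integral {-R..R} (\<lambda>k. (R\<^sup>2 - k\<^sup>2) * cos (y * k))" for y
  have J: "((\<lambda>k. (R\<^sup>2 - k\<^sup>2) * cos (y * k)) has_integral J y) {-R..R}" for y
    unfolding J_def
    by (intro integrable_integral integrable_continuous_real continuous_intros)
  have J0: "J y \<le> 2 * R ^ 3" and Jy: "y \<noteq> 0 \<Longrightarrow> J y \<le> 8 * R / y\<^sup>2" for y
    using J[of y] by (rule has_integral_parabola_cos_le[OF assms(1)])+
  have "((\<lambda>k. \<Sum>p\<in>P. \<Sum>q\<in>P. (R\<^sup>2 - k\<^sup>2) * cos ((x p - x q) * k)) has_integral
      (\<Sum>p\<in>P. \<Sum>q\<in>P. J (x p - x q))) {-R..R}"
    by (intro has_integral_sum \<open>finite P\<close> J)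
  moreover have "(\<Sum>p\<in>P. \<Sum>q\<in>P. (R\<^sup>2 - k\<^sup>2) * cos ((x p - x q) * k)) =
      (R\<^sup>2 - k\<^sup>2) * (cmod (\<Sum>p\<in>P. cis (x p * k)))\<^sup>2" for k
    by (simp add: norm_sum_cis_square sum_distrib_left left_diff_distrib)
  moreover have "(\<Sum>p\<in>P. \<Sum>q\<in>P. J (x p - x q)) \<le> C * real M"
  proof -
    have "(\<Sum>q\<in>P. J (x p - x q)) \<le> C" if p: "p \<in> P" for p
    proof -
      have "(\<Sum>q\<in>P. J (x p - x q)) = J (x p - x p) + (\<Sum>q\<in>P - {p}. J (x p - x q))"
        by (rule sum.remove[OF \<open>finite P\<close> p])
      also have "\<dots> \<le> 2 * R ^ 3 + (\<Sum>q\<in>P - {p}. 8 * R / \<delta>\<^sup>2 * (1 / (real p - real q)\<^sup>2))"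
      proof (intro add_mono sum_mono J0)
        fix q assume q: "q \<in> P - {p}"
        have pos: "0 < \<delta> * \<bar>real p - real q\<bar>"
          using q assms(1,2) by auto
        have s: "\<delta> * \<bar>real p - real q\<bar> \<le> \<bar>x p - x q\<bar>"
          using sep p q by auto
        have "x p - x q \<noteq> 0"
          using pos s by auto
        then have "J (x p - x q) \<le> 8 * R / (x p - x q)\<^sup>2"
          by (rule Jy)
        also have "\<dots> \<le> 8 * R / (\<delta> * \<bar>real p - real q\<bar>)\<^sup>2"
          using power_mono[OF s, of 2] pos assms(1,2)
          by (intro divide_left_mono mult_pos_pos) auto
        finally show "J (x p - x q) \<le> 8 * R / \<delta>\<^sup>2 * (1 / (real p - real q)\<^sup>2)"
          by (simp add: power_mult_distrib)
      qed
      also have "\<dots> \<le> 2 * R ^ 3 + (\<Sum>q\<in>{..<M} - {p}. 8 * R / \<delta>\<^sup>2 * (1 / (real p - real q)\<^sup>2))"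
        using P assms(1,2) by (intro add_left_mono sum_mono2) auto
      also have "\<dots> \<le> C"
        using sum_inverse_square_dist_le[of p M] assms(1,2)
        unfolding C_def sum_distrib_left[symmetric]
        by (intro add_left_mono mult_left_mono) auto
      finally show ?thesis .
    qed
    then have "(\<Sum>p\<in>P. \<Sum>q\<in>P. J (x p - x q)) \<le> real (card P) * C"
      by (rule sum_bounded_above)
    also have "\<dots> \<le> real M * C"
      using card_mono[OF _ P] \<open>0 \<le> C\<close> by (intro mult_right_mono) auto
    finally show ?thesis by (simp add: mult.commute)
  qed
  ultimately show ?thesis
    unfolding C_def by auto
qed

section \<open>Exponential sums of words and their renormalization\<close>

text \<open>Summing over indices instead of the set of positions permits induction on the
  word.\<close>

definition exponential_sum :: "real^'a::finite \<Rightarrow> 'a list \<Rightarrow> 'a \<Rightarrow> real \<Rightarrow> complex" where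
  "exponential_sum l w i k =
     (\<Sum>p | p < length w \<and> w ! p = i. cis (2 * pi * tile_position l w p * k))"

definition word_length :: "real^'a::finite \<Rightarrow> 'a list \<Rightarrow> real" where
  "word_length l w = (\<Sum>a\<leftarrow>w. l $ a)"

text \<open>The word of the \<open>n\<close>-fold inflation of \<open>a\<close>. The recursion
  substitutes once and then inflates \<open>n\<close> times, matching the cocycle, which gains its
  new factor at scale \<lambda>^n on the right.\<close>

primrec iterate :: "('a \<Rightarrow> 'a list) \<Rightarrow> nat \<Rightarrow> 'a \<Rightarrow> 'a list" where
  "iterate \<rho> 0 a = [a]"
| "iterate \<rho> (Suc n) a = concat (map (iterate \<rho> n) (\<rho> a))"

lemma tile_position_0 [simp]: "tile_position l w 0 = 0"
  by (simp add: tile_position_def)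

lemma tile_position_Cons_Suc [simp]: "tile_position l (a # w) (Suc p) = l $ a + tile_position l w p"
  by (simp add: tile_position_def sum.lessThan_Suc_shift del: sum.lessThan_Suc)

lemma exponential_sum_Nil [simp]: "exponential_sum l [] i k = 0"
  by (simp add: exponential_sum_def)

lemma exponential_sum_Cons [simp]:
  "exponential_sum l (a # w) i k =
     (if a = i then 1 else 0) + cis (2 * pi * l $ a * k) * exponential_sum l w i k"
proof -
  have *: "exponential_sum l w i k =
     (\<Sum>p<length w. if w ! p = i then cis (2 * pi * tile_position l w p * k) else 0)" for w
    unfolding exponential_sum_def by (subst sum.inter_filter[symmetric]) auto
  show ?thesis
    unfolding * by (simp add: sum.lessThan_Suc_shift sum_distrib_left cis_mult algebra_simps
        if_distrib[of "\<lambda>x. _ * x"] del: sum.lessThan_Suc cong: if_cong)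
qed

lemma word_length_simps [simp]:
  "word_length l [] = 0" "word_length l (a # w) = l $ a + word_length l w"
  by (simp_all add: word_length_def)

text \<open>The tiles of \<open>v\<close> are shifted by the length of \<open>u\<close>, which is a
  phase factor.\<close>

lemma exponential_sum_append:
  "exponential_sum l (u @ v) i k =
     exponential_sum l u i k + cis (2 * pi * word_length l u * k) * exponential_sum l v i k"
  by (induction u) (simp_all add: algebra_simps flip: cis_mult)

lemma word_length_concat_map:
  assumes "\<And>a. word_length l (f a) = c * l $ a"
  shows "word_length l (concat (map f w)) = c * word_length l w"
proof (induction w)
  case (Cons a w)
  have "word_length l (u @ v) = word_length l u + word_length l v" for u v
    by (simp add: word_length_def)
  then show ?case
    using Cons assms by (simp add: algebra_simps)
qed simp

text \<open>The patch replacing a tile of \<open>w\<close> starts at \<open>c\<close> times the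
  position of that tile. Grouping the tiles of \<open>w\<close> by type and moving the factor
  \<open>c\<close> from the positions to \<open>k\<close> gives the entry of a matrix
  product.\<close>

lemma exponential_sum_concat_map:
  assumes "\<And>a. word_length l (f a) = c * l $ a"
  shows "exponential_sum l (concat (map f w)) i k =
     (\<Sum>m\<in>UNIV. exponential_sum l (f m) i k * exponential_sum l w m (c * k))"
proof (induction w)
  case (Cons a w)
  show ?case
    using Cons assms
    by (simp add: exponential_sum_append sum.distrib distrib_left sum_distrib_left mult_ac
        if_distrib[of "\<lambda>x. x * _"] cong: if_cong)
qed simp

lemma tile_position_diff_ge:
  assumes "\<And>i. \<delta> \<le> l $ i" "q \<le> p"
  shows "\<delta> * (real p - real q) \<le> tile_position l w p - tile_position l w q"
  using assms(2)
proof (induction p rule: dec_induct)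
  case (step p)
  then show ?case using assms(1)[of "w ! p"]
    by (simp add: tile_position_def algebra_simps)
qed simp

lemma tile_position_separated:
  assumes "\<And>i. \<delta> \<le> l $ i"
  shows "\<delta> * \<bar>real p - real q\<bar> \<le> \<bar>tile_position l w p - tile_position l w q\<bar>"
  using tile_position_diff_ge[OF assms, of q p w] tile_position_diff_ge[OF assms, of p q w]
  by (cases "q \<le> p") auto

lemma length_le_word_length:
  assumes "\<And>i. \<delta> \<le> l $ i"
  shows "\<delta> * real (length w) \<le> word_length l w"
proof (induction w)
  case (Cons a w)
  then show ?case using assms[of a] by (simp add: algebra_simps)
qed simp

lemma positive_vector_bounded_below:
  fixes l :: "real^'a::finite"
  assumes "\<And>i. 0 < l $ i"
  obtains \<delta> where "0 < \<delta>" "\<And>i. \<delta> \<le> l $ i"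
  using that[of "Min (range (\<lambda>i. l $ i))"] assms by auto

lemma word_length_substitution:
  assumes "left_pf_eigenvector (substitution_matrix \<rho>) l"
  shows "word_length l (\<rho> a) = inflation_multiplier \<rho> * l $ a"
proof -
  have "inflation_multiplier \<rho> * l $ a = (l v* substitution_matrix \<rho>) $ a"
    using assms by (simp add: left_pf_eigenvector_def inflation_multiplier_def)
  also have "\<dots> = (\<Sum>i\<in>UNIV. l $ i * real (count_list (\<rho> a) i))"
    by (simp add: vector_matrix_mult_def substitution_matrix_def)
  \<comment> \<open>The image word is generalized to an arbitrary \<open>w\<close>, on which
    induction is possible.\<close>
  also have "\<dots> = word_length l w" if "w = \<rho> a" for w
    unfolding that[symmetric]
  proof (induction w)
    case (Cons b w)
    have "(\<Sum>i\<in>UNIV. l $ i * real (count_list (b # w) i)) =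
        (\<Sum>i\<in>UNIV. (if b = i then l $ i else 0) + l $ i * real (count_list w i))"
      by (intro sum.cong refl) (simp add: algebra_simps)
    then show ?case
      using Cons by (simp add: sum.distrib)
  qed simp
  finally show ?thesis by simp
qed

lemma word_length_iterate:
  assumes "left_pf_eigenvector (substitution_matrix \<rho>) l"
  shows "word_length l (iterate \<rho> n a) = inflation_multiplier \<rho> ^ n * l $ a"
proof (induction n arbitrary: a)
  case (Suc n)
  show ?case
    using word_length_concat_map[OF Suc] word_length_substitution[OF assms] by simp
qed simp

text \<open>Since lengths are positive, distinct tiles have distinct positions, so no term is lost
  in passing to the displacement set.\<close>

lemma fourier_matrix_eq_exponential_sum:
  assumes "\<And>i. 0 < l $ i"
  shows "fourier_matrix \<rho> l k $ i $ j = exponential_sum l (\<rho> j) i k"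
proof -
  obtain \<delta> where \<delta>: "0 < \<delta>" "\<And>i. \<delta> \<le> l $ i"
    using positive_vector_bounded_below[of l] assms by metis
  \<comment> \<open>This holds on all of \<open>nat\<close>: past the end of the word
    \<open>!\<close> still yields some letter, and every letter has length at least
    \<open>\<delta>\<close>.\<close>
  have "inj (tile_position l (\<rho> j))"
  proof (rule injI)
    fix p q assume "tile_position l (\<rho> j) p = tile_position l (\<rho> j) q"
    then have "\<delta> * \<bar>real p - real q\<bar> \<le> 0"
      using tile_position_separated[OF \<delta>(2), of p q "\<rho> j"] by simp
    then show "p = q"
      using \<delta>(1) by (simp add: mult_le_0_iff)
  qed
  moreover have "displacement_set \<rho> l i j = tile_position l (\<rho> j) ` {p. p < length (\<rho> j) \<and> \<rho> j ! p = i}"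
    by (auto simp: displacement_set_def)
  ultimately show ?thesis
    by (simp add: fourier_matrix_def exponential_sum_def sum.reindex inj_on_subset cis_conv_exp mult_ac)
qed

lemma fourier_cocycle_eq_exponential_sum:
  assumes "left_pf_eigenvector (substitution_matrix \<rho>) l"
  shows "fourier_cocycle \<rho> l n k $ i $ j = exponential_sum l (iterate \<rho> n j) i k"
proof (induction n arbitrary: i j)
  case 0
  show ?case by (simp add: mat_def)
next
  case (Suc n)
  have "\<And>i. 0 < l $ i"
    using assms by (simp add: left_pf_eigenvector_def)
  then show ?case
    by (simp add: matrix_matrix_mult_def Suc fourier_matrix_eq_exponential_sum
        exponential_sum_concat_map[OF word_length_iterate[OF assms]])
qed

section \<open>Control of an arbitrary matrix norm by the entries\<close>

text \<open>Expansion in the matrix units \<open>E i j\<close>, then the triangle inequality and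
  homogeneity.\<close>

lemma matrix_norm_le_entries:
  assumes "matrix_norm N"
  obtains D where "0 < D" "\<And>A r. (\<And>i j. cmod (A $ i $ j) \<le> r) \<Longrightarrow> N A \<le> D * r"
proof
  define E :: "'a \<Rightarrow> 'a \<Rightarrow> complex^'a^'a"
    where "E i j = (\<chi> a b. if a = i \<and> b = j then 1 else 0)" for i j
  define D where "D = 1 + (\<Sum>i\<in>UNIV. \<Sum>j\<in>UNIV. N (E i j))"
  have N0: "0 \<le> N A" and Nz: "N 0 = 0" and tri: "N (A + B) \<le> N A + N B"
    and hom: "N (\<chi> i j. c * A $ i $ j) = cmod c * N A" for A B c
    using assms by (auto simp: matrix_norm_def)
  have Nsum: "N (\<Sum>x\<in>X. f x) \<le> (\<Sum>x\<in>X. N (f x))" for X :: "'a set" and f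
    by (induction X rule: infinite_finite_induct) (auto simp: Nz intro: order_trans[OF tri])
  show "0 < D"
    unfolding D_def by (intro add_pos_nonneg sum_nonneg N0) auto
  fix A :: "complex^'a^'a" and r assume r: "\<And>i j. cmod (A $ i $ j) \<le> r"
  then have r0: "0 \<le> r"
    using norm_ge_zero order_trans by blast
  have "A = (\<Sum>i\<in>UNIV. \<Sum>j\<in>UNIV. \<chi> a b. A $ i $ j * E i j $ a $ b)"
  proof -
    have "(\<Sum>i\<in>UNIV. \<Sum>j\<in>UNIV. if a = i \<and> b = j then A $ i $ j else 0) =
        (\<Sum>i\<in>UNIV. if a = i then A $ i $ b else 0)" for a b
      by (intro sum.cong refl) auto
    then show ?thesis
      by (simp add: vec_eq_iff E_def if_distrib[of "\<lambda>x. _ * x"] cong: if_cong)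
  qed
  then have "N A = N (\<Sum>i\<in>UNIV. \<Sum>j\<in>UNIV. \<chi> a b. A $ i $ j * E i j $ a $ b)"
    by (rule arg_cong)
  also have "\<dots> \<le> (\<Sum>i\<in>UNIV. N (\<Sum>j\<in>UNIV. \<chi> a b. A $ i $ j * E i j $ a $ b))"
    by (rule Nsum)
  also have "\<dots> \<le> (\<Sum>i\<in>UNIV. \<Sum>j\<in>UNIV. cmod (A $ i $ j) * N (E i j))"
    by (intro sum_mono order_trans[OF Nsum]) (simp add: hom)
  also have "\<dots> \<le> (\<Sum>i\<in>UNIV. \<Sum>j\<in>UNIV. r * N (E i j))"
    by (intro sum_mono mult_right_mono r N0)
  also have "\<dots> \<le> D * r"
    using r0 by (simp add: D_def algebra_simps sum_distrib_left)
  finally show "N A \<le> D * r" .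
qed


section \<open>Almost sure growth of the exponential sums\<close>

text \<open>Sum and integral of nonnegative functions commute, so the weighted series has a finite
  integral and is finite almost everywhere. For \<open>\<bar>k\<bar> < R\<close> the weight is
  strictly positive and cancels.\<close>

lemma AE_summable_of_summable_weighted_integrals:
  fixes g :: "nat \<Rightarrow> real \<Rightarrow> real"
  assumes nonneg: "\<And>n k. 0 \<le> g n k"
    and meas: "\<And>n. g n \<in> borel_measurable borel"
    and int: "\<And>n. ((\<lambda>k. (R\<^sup>2 - k\<^sup>2) * g n k) has_integral I n) {-R..R}"
    and summ: "summable I"
  shows "AE k in lborel. \<bar>k\<bar> < R \<longrightarrow> summable (\<lambda>n. g n k)"
proof -
  define h where "h n k = indicator {-R..R} k * ((R\<^sup>2 - k\<^sup>2) * g n k)" for n k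
  have weight: "0 \<le> (R\<^sup>2 - k\<^sup>2) * g n k" if "k \<in> {-R..R}" for n k
  proof -
    have "k\<^sup>2 \<le> R\<^sup>2"
      using that by (intro abs_le_square_iff[THEN iffD1]) auto
    then show ?thesis using nonneg by simp
  qed
  have [measurable]: "h n \<in> borel_measurable borel" for n
    unfolding h_def using meas[of n] by measurable
  have h: "(\<integral>\<^sup>+k. ennreal (h n k) \<partial>lborel) = ennreal (I n)" for n
    unfolding h_def by (intro nn_integral_has_integral_lebesgue weight int)
  have I0: "0 \<le> I n" for n
    using has_integral_nonneg[OF int] weight by blast
  have "(\<integral>\<^sup>+k. (\<Sum>n. ennreal (h n k)) \<partial>lborel) = (\<Sum>n. ennreal (I n))"
    by (subst nn_integral_suminf) (auto simp: h)
  also have "\<dots> = ennreal (\<Sum>n. I n)"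
    by (rule suminf_ennreal2[OF I0 summ])
  finally have "(\<integral>\<^sup>+k. (\<Sum>n. ennreal (h n k)) \<partial>lborel) \<noteq> \<infinity>"
    by simp
  then have "AE k in lborel. (\<Sum>n. ennreal (h n k)) \<noteq> \<infinity>"
    by (intro nn_integral_PInf_AE) measurable
  then show ?thesis
  proof (rule AE_mp, intro AE_I2 impI)
    fix k assume fin: "(\<Sum>n. ennreal (h n k)) \<noteq> \<infinity>" and k: "\<bar>k\<bar> < R"
    have "summable (\<lambda>n. h n k)"
      using fin weight by (intro summable_suminf_not_top) (auto simp: h_def indicator_def)
    moreover have "h n k = (R\<^sup>2 - k\<^sup>2) * g n k" for n
      using k by (auto simp: h_def indicator_def)
    moreover have "k\<^sup>2 < R\<^sup>2"
      using k by (intro power2_strict_mono) auto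
    ultimately show "summable (\<lambda>n. g n k)"
      by (simp add: summable_cmult_iff)
  qed
qed

text \<open>The word \<open>iterate \<rho> n j\<close> has total length \<lambda>^n times
  \<open>l $ j\<close>, hence at most that length divided by \<open>\<delta>\<close> letters. After
  normalization the mean squares are bounded by a multiple of the inverse squares.\<close>

lemma AE_exponential_sum_iterate_bound:
  assumes pf: "left_pf_eigenvector (substitution_matrix \<rho>) l"
    and multiplier_pos: "0 < inflation_multiplier \<rho>"
  shows "AE k in lborel. \<forall>\<^sub>F n in sequentially.
    (cmod (exponential_sum l (iterate \<rho> n j) i k))\<^sup>2 \<le> (real (Suc n))\<^sup>2 * inflation_multiplier \<rho> ^ n"
proof -
  define L where "L = inflation_multiplier \<rho>"
  \<comment> \<open>\<open>Suc n\<close> avoids a zero denominator at \<open>n = 0\<close>; its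
    square makes the integrals summable and is subexponential.\<close>
  define g where "g n k = (cmod (exponential_sum l (iterate \<rho> n j) i k))\<^sup>2 / ((real (Suc n))\<^sup>2 * L ^ n)" for n k
  obtain \<delta> where \<delta>: "0 < \<delta>" "\<And>i. \<delta> \<le> l $ i"
    using positive_vector_bounded_below[of l] pf by (auto simp: left_pf_eigenvector_def)
  \<comment> \<open>Integer radii suffice to exhaust the line and leave only countably many null
    sets to unite.\<close>
  have "AE k in lborel. \<bar>k\<bar> < real r \<longrightarrow> summable (\<lambda>n. g n k)" for r :: nat
  proof -
    define C where "C = 2 * real r ^ 3 + 8 * real r / \<delta>\<^sup>2 * (pi\<^sup>2 / 3)"
    have C: "0 \<le> C"
      by (simp add: C_def)
    have "\<exists>I \<le> C * l $ j / \<delta> * (1 / (real (Suc n))\<^sup>2).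
        ((\<lambda>k. ((real r)\<^sup>2 - k\<^sup>2) * g n k) has_integral I) {-real r..real r}" for n
    proof -
      define w where "w = iterate \<rho> n j"
      define c where "c = (real (Suc n))\<^sup>2 * L ^ n"
      have c: "0 < c" using multiplier_pos by (simp add: c_def L_def)
      have "\<exists>I \<le> C * real (length w). ((\<lambda>k. ((real r)\<^sup>2 - k\<^sup>2) *
          (cmod (\<Sum>p | p < length w \<and> w ! p = i. cis (2 * pi * tile_position l w p * k)))\<^sup>2)
          has_integral I) {-real r..real r}"
      proof (unfold C_def, rule separated_exponential_sum_mean_square[OF of_nat_0_le_iff \<delta>(1)])
        fix p q
        have "\<delta> * \<bar>real p - real q\<bar> \<le> 1 * \<bar>tile_position l w p - tile_position l w q\<bar>"
          using tile_position_separated[OF \<delta>(2)] by simp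
        \<comment> \<open>The factor \<open>2 * pi\<close> only widens the gaps, so
          \<open>\<delta>\<close> still separates the frequencies.\<close>
        also have "\<dots> \<le> (2 * pi) * \<bar>tile_position l w p - tile_position l w q\<bar>"
          using pi_gt3 by (intro mult_right_mono) auto
        also have "\<dots> = \<bar>2 * pi * tile_position l w p - 2 * pi * tile_position l w q\<bar>"
          by (simp add: abs_mult flip: right_diff_distrib)
        finally show "\<delta> * \<bar>real p - real q\<bar> \<le>
            \<bar>2 * pi * tile_position l w p - 2 * pi * tile_position l w q\<bar>" .
      qed auto
      then obtain I where I: "I \<le> C * real (length w)"
        "((\<lambda>k. ((real r)\<^sup>2 - k\<^sup>2) * (cmod (exponential_sum l w i k))\<^sup>2) has_integral I) {-real r..real r}"
        by (auto simp: exponential_sum_def)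
      have "((\<lambda>k. ((real r)\<^sup>2 - k\<^sup>2) * g n k) has_integral (I / c)) {-real r..real r}"
        using has_integral_divide[OF I(2), of c] by (simp add: g_def w_def c_def)
      moreover have "I / c \<le> C * l $ j / \<delta> * (1 / (real (Suc n))\<^sup>2)"
      proof -
        have "real (length w) \<le> L ^ n * l $ j / \<delta>"
          using length_le_word_length[OF \<delta>(2), of w] \<delta>(1)
          by (simp add: w_def word_length_iterate[OF pf] L_def field_simps)
        then have "C * real (length w) \<le> C * (L ^ n * l $ j / \<delta>)"
          using C by (rule mult_left_mono)
        then have "I / c \<le> C * (L ^ n * l $ j / \<delta>) / c"
          using I(1) c by (intro divide_right_mono) auto
        also have "\<dots> = C * l $ j / \<delta> * (1 / (real (Suc n))\<^sup>2)"
          using multiplier_pos by (simp add: c_def L_def del: of_nat_Suc)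
        finally show ?thesis .
      qed
      ultimately show ?thesis by blast
    qed
    then obtain I where I: "\<And>n. I n \<le> C * l $ j / \<delta> * (1 / (real (Suc n))\<^sup>2)"
      and int: "\<And>n. ((\<lambda>k. ((real r)\<^sup>2 - k\<^sup>2) * g n k) has_integral I n) {-real r..real r}"
      by metis
    have g0: "0 \<le> g n k" for n k
      using multiplier_pos by (simp add: g_def L_def)
    have I0: "0 \<le> I n" for n
    proof (rule has_integral_nonneg[OF int])
      fix k assume "k \<in> {-real r..real r}"
      then have "k\<^sup>2 \<le> (real r)\<^sup>2"
        by (intro abs_le_square_iff[THEN iffD1]) auto
      then show "0 \<le> ((real r)\<^sup>2 - k\<^sup>2) * g n k"
        using g0 by simp
    qed
    have "summable (\<lambda>n. C * l $ j / \<delta> * (1 / (real (Suc n))\<^sup>2))"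
      using inverse_squares_sums[THEN sums_summable] by (intro summable_mult) (simp add: add.commute)
    then have "summable I"
    proof (rule summable_comparison_test')
      show "norm (I n) \<le> C * l $ j / \<delta> * (1 / (real (Suc n))\<^sup>2)" if "0 \<le> n" for n
        using I[of n] I0[of n] by (simp del: of_nat_Suc)
    qed
    moreover have "g n \<in> borel_measurable borel" for n
      unfolding g_def exponential_sum_def cis_conv_exp
      by (intro borel_measurable_divide borel_measurable_const borel_measurable_continuous_onI
          continuous_intros)
    ultimately show ?thesis
      by (intro AE_summable_of_summable_weighted_integrals[OF g0 _ int]) blast+
  qed
  then have "AE k in lborel. \<forall>r. \<bar>k\<bar> < real r \<longrightarrow> summable (\<lambda>n. g n k)"
    unfolding AE_all_countable by blast
  then show ?thesis
  proof (rule AE_mp, intro AE_I2 impI)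
    fix k assume "\<forall>r. \<bar>k\<bar> < real r \<longrightarrow> summable (\<lambda>n. g n k)"
    then have "summable (\<lambda>n. g n k)"
      using reals_Archimedean2 by blast
    then have "(\<lambda>n. g n k) \<longlonglongrightarrow> 0"
      by (rule summable_LIMSEQ_zero)
    then have "\<forall>\<^sub>F n in sequentially. g n k < 1"
      by (rule order_tendstoD) simp
    then show "\<forall>\<^sub>F n in sequentially. (cmod (exponential_sum l (iterate \<rho> n j) i k))\<^sup>2
        \<le> (real (Suc n))\<^sup>2 * inflation_multiplier \<rho> ^ n"
    proof eventually_elim
      case (elim n)
      have "0 < (real (Suc n))\<^sup>2 * L ^ n"
        using multiplier_pos by (simp add: L_def)
      with elim show ?case
        unfolding g_def L_def[symmetric] by (simp add: divide_less_eq del: of_nat_Suc)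
    qed
  qed
qed

text \<open>After taking logarithms and dividing by \<open>n\<close>, the norm constant
  \<open>D\<close> and the factor \<open>Suc n\<close> vanish in the limit; only the logarithm of
  \<open>s\<close> remains.\<close>

lemma lyapunov_exponent_le:
  assumes N: "matrix_norm N"
    and multiplier_pos: "0 < inflation_multiplier \<rho>"
    and bound: "\<forall>\<^sub>F n in sequentially. \<forall>i j.
      (cmod (fourier_cocycle \<rho> l n k $ i $ j))\<^sup>2 \<le> (real (Suc n))\<^sup>2 * inflation_multiplier \<rho> ^ n"
  shows "lyapunov_exponent N \<rho> l k \<le> ereal (ln (sqrt (inflation_multiplier \<rho>)))"
proof -
  define s where "s = sqrt (inflation_multiplier \<rho>)"
  have s: "0 < s" "inflation_multiplier \<rho> = s\<^sup>2"
    using multiplier_pos by (auto simp: s_def)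
  obtain D where D: "0 < D" "\<And>A r. (\<And>i j. cmod (A $ i $ j) \<le> r) \<Longrightarrow> N A \<le> D * r"
    using matrix_norm_le_entries[OF N] by metis
  define b where "b n = (ln D + ln (real (Suc n))) / real n + ln s" for n
  have "\<forall>\<^sub>F n in sequentially. ereal (1 / real n) * log_ereal (N (fourier_cocycle \<rho> l n k)) \<le> ereal (b n)"
    \<comment> \<open>At \<open>n = 0\<close> the factor \<open>1 / real n\<close> is
      \<open>0\<close>. It must be positive to preserve the value -\<infinity> of
      \<open>log_ereal 0\<close>, and to cancel the \<open>n\<close> in
      \<open>real n * ln s\<close>.\<close>
    using bound eventually_gt_at_top[of 0]
  proof eventually_elim
    case (elim n)
    let ?x = "N (fourier_cocycle \<rho> l n k)"
    have "cmod (fourier_cocycle \<rho> l n k $ i $ j) \<le> real (Suc n) * s ^ n" for i j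
    proof (rule power2_le_imp_le)
      show "(cmod (fourier_cocycle \<rho> l n k $ i $ j))\<^sup>2 \<le> (real (Suc n) * s ^ n)\<^sup>2"
        using elim(1) by (simp add: s(2) power_mult_distrib mult.commute flip: power_mult)
      show "0 \<le> real (Suc n) * s ^ n"
        using s(1) by simp
    qed
    then have x: "?x \<le> D * (real (Suc n) * s ^ n)"
      by (rule D(2))
    show ?case
    proof (cases "?x = 0")
      case True
      then show ?thesis using elim(2) by (simp add: log_ereal_def)
    next
      case False
      then have pos: "0 < ?x"
        using N by (metis matrix_norm_def less_eq_real_def)
      have "ln ?x \<le> ln (D * (real (Suc n) * s ^ n))"
        using x pos by simp
      also have "\<dots> = ln D + ln (real (Suc n)) + real n * ln s"
        using D(1) s(1) by (simp add: ln_mult ln_realpow del: of_nat_Suc)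
      finally have "1 / real n * ln ?x \<le> 1 / real n * (ln D + ln (real (Suc n)) + real n * ln s)"
        by (intro mult_left_mono) auto
      also have "\<dots> = b n"
        using elim(2) by (simp add: b_def field_simps)
      finally show ?thesis
        using False by (simp add: log_ereal_def)
    qed
  qed
  then have "lyapunov_exponent N \<rho> l k \<le> limsup (\<lambda>n. ereal (b n))"
    unfolding lyapunov_exponent_def by (rule Limsup_mono)
  also have "b \<longlonglongrightarrow> ln s"
    unfolding b_def by real_asymp
  then have "limsup (\<lambda>n. ereal (b n)) = ereal (ln s)"
    by (intro lim_imp_Limsup) auto
  finally show ?thesis by (simp add: s_def)
qed

theorem theorem3p34:
  fixes \<rho> :: "'a::finite \<Rightarrow> 'a list"
    and l :: "real^'a"
    and N :: "complex^'a^'a \<Rightarrow> real"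
  assumes "primitive_substitution \<rho>"
    and "1 < inflation_multiplier \<rho>"
    and "left_pf_eigenvector (substitution_matrix \<rho>) l"
    and "matrix_norm N"
  shows "(AE k in lebesgue. 0 \<le> min_exponent N \<rho> l k) \<and>
         (AE k in lebesgue. lyapunov_exponent N \<rho> l k \<le> ereal (ln (sqrt (inflation_multiplier \<rho>)))) \<and>
         (\<forall>k. 0 \<le> min_exponent N \<rho> l k \<longleftrightarrow>
              lyapunov_exponent N \<rho> l k \<le> ereal (ln (sqrt (inflation_multiplier \<rho>))))"
proof -
  have multiplier_pos: "0 < inflation_multiplier \<rho>"
    using assms(2) by simp
  \<comment> \<open>The case split covers infinite exponents: subtracting -\<infinity> from a real
    gives \<infinity>, and subtracting \<infinity> gives -\<infinity>.\<close>
  have iff: "0 \<le> min_exponent N \<rho> l k \<longleftrightarrow>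
      lyapunov_exponent N \<rho> l k \<le> ereal (ln (sqrt (inflation_multiplier \<rho>)))" for k
    unfolding min_exponent_def by (cases "lyapunov_exponent N \<rho> l k") auto
  \<comment> \<open>There are finitely many index pairs, so the exceptional null sets unite here,
    and below the thresholds in \<open>n\<close> merge into one.\<close>
  have "AE k in lborel. \<forall>i j. \<forall>\<^sub>F n in sequentially.
      (cmod (fourier_cocycle \<rho> l n k $ i $ j))\<^sup>2 \<le> (real (Suc n))\<^sup>2 * inflation_multiplier \<rho> ^ n"
    unfolding fourier_cocycle_eq_exponential_sum[OF assms(3)]
    using AE_exponential_sum_iterate_bound[OF assms(3) multiplier_pos] by (simp add: AE_all_countable)
  then have "AE k in lborel. lyapunov_exponent N \<rho> l k \<le> ereal (ln (sqrt (inflation_multiplier \<rho>)))"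
    by (rule AE_mp)
      (intro AE_I2 impI lyapunov_exponent_le assms(4) multiplier_pos, simp add: eventually_all_finite)
  \<comment> \<open>Lebesgue measure is the completion of \<open>lborel\<close>, so null sets remain
    null.\<close>
  then have "AE k in lebesgue. lyapunov_exponent N \<rho> l k \<le> ereal (ln (sqrt (inflation_multiplier \<rho>)))"
    by (rule AE_completion)
  then show ?thesis
    by (simp add: iff)
qed

end
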